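(* Let $N=\mathbb{S}^3$ or $\mathbb{H}^3$, with $\sigma=1$, $G=SO(4)$ when $N=\mathbb{S}^3$ and $\sigma=-1$, $G=SO(1,3)$ when $N=\mathbb{H}^3$. Let $\gamma(x,t)\in N$ be a solution, parametrized by arc length $x$, of the Hodge star mean curvature flow $\gamma_t=*_\gamma(H(\gamma(\cdot,t)))$, with principal curvatures $k_1,k_2$, and let $g\in G$ be a parallel frame along $\gamma$. Then $k(\cdot,t)=(k_1+ik_2)(\cdot,t)$ solves $$k_t=i\left(k_{xx}+\sigma k+\tfrac12|k|^2k\right).$$
   Context: $\mathbb{S}^3$ is the unit sphere in Euclidean $\mathbb{R}^4$; $\mathbb{H}^3$ is the hyperquadric $-x_0^2+x_1^2+x_2^2+x_3^2=-1$ in Minkowski space $\mathbb{R}^{3,1}$ with metric $-dx_0^2+dx_1^2+dx_2^2+dx_3^2$. Star mean curvature flow: $H(\gamma(\cdot,t))$ is the mean curvature vector of the curve $\gamma(\cdot,t)$ in $N$, and $*_\gamma$ is the Hodge star operator on the oriented normal plane of the curve in $N$, i.e. rotation by $\pi/2$: $*(n_2)=n_3$, $*(n_3)=-n_2$ for an oriented orthonormal basis $(n_2,n_3)$. If $(\gamma,\gamma_x,n_2,n_3)$ is an orthonormal frame along $\gamma$ and $H=\xi_1n_2+\xi_2n_3$, the flow reads $\gamma_t=\xi_1n_3-\xi_2n_2$. Parallel frame: an orthonormal frame $g=(e_0,e_1,e_2,e_3)$ along $\gamma$ with $e_0=\gamma$, $e_1=\gamma_x$ such that $$g^{-1}g_x=\begin{pmatrix}0&-\sigma&0&0\\1&0&-k_1&-k_2\\0&k_1&0&0\\0&k_2&0&0\end{pmatrix}.$$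 The functions $k_1,k_2$ are called the principal curvatures of $\gamma$ along $e_2,e_3$.
   Formalization: A parallel frame is free up to a rotation of the normal plane by an angle depending on t, which breaks the equation for k; so the equation is proved for frames with <∂_t e_2, e_3> = -|k|^2/2, and every smooth parallel frame is shown to become one after such a rotation. *)

theory Defs
  imports "HOL-Analysis.Analysis"
begin

text \<open>
  The two geometries are indexed by \<open>\<sigma> \<in> {1, -1}\<close>: \<open>\<sigma> = 1\<close> is \<open>S\<^sup>3\<close> in Euclidean 4-space,
  \<open>\<sigma> = -1\<close> is \<open>H\<^sup>3\<close> in Minkowski space. The coordinates \<open>x\<^sub>0, x\<^sub>1, x\<^sub>2, x\<^sub>3\<close> are the components
  \<open>1, 2, 3, 4\<close> of \<^typ>\<open>real^4\<close> (in the index type \<open>4\<close> one has \<open>0 = 4\<close>, so counting from 0 is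
  avoided).
\<close>

definition bform :: "real \<Rightarrow> real^4 \<Rightarrow> real^4 \<Rightarrow> real" where
  "bform \<sigma> v w = \<sigma> * v$1 * w$1 + v$2 * w$2 + v$3 * w$3 + v$4 * w$4"

definition space_form :: "real \<Rightarrow> (real^4) set" where
  "space_form \<sigma> = {p. bform \<sigma> p p = \<sigma>}"

definition gram :: "real \<Rightarrow> real^4^4" where
  "gram \<sigma> = vector [vector [\<sigma>, 0, 0, 0],
                    vector [0, 1, 0, 0],
                    vector [0, 0, 1, 0],
                    vector [0, 0, 0, 1]]"

text \<open>\<open>SO(4)\<close> for \<open>\<sigma> = 1\<close>, \<open>SO(1,3)\<close> for \<open>\<sigma> = -1\<close>.\<close>

definition SO_group :: "real \<Rightarrow> (real^4^4) set" where
  "SO_group \<sigma> = {g. transpose g ** gram \<sigma> ** g = gram \<sigma> \<and> det g = 1}"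

definition frame_matrix :: "real^4 \<Rightarrow> real^4 \<Rightarrow> real^4 \<Rightarrow> real^4 \<Rightarrow> real^4^4" where
  "frame_matrix p v n2 n3 = transpose (vector [p, v, n2, n3])"


definition dx :: "(real \<Rightarrow> real \<Rightarrow> 'a::real_normed_vector) \<Rightarrow> real \<Rightarrow> real \<Rightarrow> 'a" where
  "dx f x t = vector_derivative (\<lambda>y. f y t) (at x)"

definition dt :: "(real \<Rightarrow> real \<Rightarrow> 'a::real_normed_vector) \<Rightarrow> real \<Rightarrow> real \<Rightarrow> 'a" where
  "dt f x t = vector_derivative (\<lambda>s. f x s) (at t)"

text \<open>\<open>C\<^sup>n\<close> on an open set \<open>S\<close> of pairs \<open>(x, t)\<close>.\<close>

primrec Cn_on :: "nat \<Rightarrow> (real \<times> real) set \<Rightarrow> (real \<Rightarrow> real \<Rightarrow> 'a::real_normed_vector) \<Rightarrow> bool" where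
  "Cn_on 0 S f \<longleftrightarrow> continuous_on S (\<lambda>(x, t). f x t)"
| "Cn_on (Suc n) S f \<longleftrightarrow>
     (\<forall>p\<in>S. (\<lambda>(x, t). f x t) differentiable (at p)) \<and> Cn_on n S (dx f) \<and> Cn_on n S (dt f)"

definition smooth_on :: "(real \<times> real) set \<Rightarrow> (real \<Rightarrow> real \<Rightarrow> 'a::real_normed_vector) \<Rightarrow> bool" where
  "smooth_on S f \<longleftrightarrow> (\<forall>n. Cn_on n S f)"


text \<open>
  The component of \<open>a\<close> orthogonal to \<open>p\<close> and \<open>v\<close>, where \<open>p\<close> and \<open>v\<close> are orthogonal. For \<open>p\<close> on
  the space form and \<open>v\<close> tangent to a curve through \<open>p\<close>, this is the normal component, within
  the space form, of the Levi-Civita covariant derivative obtained from the ambient derivative \<open>a\<close>.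
\<close>

definition normal_part :: "real \<Rightarrow> real^4 \<Rightarrow> real^4 \<Rightarrow> real^4 \<Rightarrow> real^4" where
  "normal_part \<sigma> p v a =
     a - (bform \<sigma> a p / bform \<sigma> p p) *\<^sub>R p - (bform \<sigma> a v / bform \<sigma> v v) *\<^sub>R v"

text \<open>
  The mean curvature vector in the space form: the trace \<open>II(c', c') / \<langle>c', c'\<rangle>\<close> of the second
  fundamental form of the curve \<open>c\<close>.
\<close>

definition mean_curvature_vector :: "real \<Rightarrow> (real \<Rightarrow> real^4) \<Rightarrow> real \<Rightarrow> real^4" where
  "mean_curvature_vector \<sigma> c x =
     (let v = vector_derivative c (at x);
          a = vector_derivative (\<lambda>y. vector_derivative c (at y)) (at x)
      in normal_part \<sigma> (c x) v a /\<^sub>R bform \<sigma> v v)"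

text \<open>
  The Hodge star on the oriented normal plane at \<open>p\<close> of a curve with unit tangent \<open>v\<close>. It is
  meaningful for \<open>n\<close> in that plane, where the rotation by \<open>\<pi>/2\<close> does not depend on the oriented
  orthonormal basis \<open>(n2, n3)\<close> of the plane.
\<close>

definition hodge_star :: "real \<Rightarrow> real^4 \<Rightarrow> real^4 \<Rightarrow> real^4 \<Rightarrow> real^4" where
  "hodge_star \<sigma> p v n =
     (THE w. \<exists>n2 n3 a b. frame_matrix p v n2 n3 \<in> SO_group \<sigma> \<and>
        n = a *\<^sub>R n2 + b *\<^sub>R n3 \<and> w = a *\<^sub>R n3 - b *\<^sub>R n2)"

definition star_mcf :: "real \<Rightarrow> real set \<Rightarrow> real set \<Rightarrow> (real \<Rightarrow> real \<Rightarrow> real^4) \<Rightarrow> bool" where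
  "star_mcf \<sigma> J T \<gamma> \<longleftrightarrow>
     smooth_on (J \<times> T) \<gamma> \<and>
     (\<forall>x\<in>J. \<forall>t\<in>T.
        \<gamma> x t \<in> space_form \<sigma> \<and>
        bform \<sigma> (dx \<gamma> x t) (dx \<gamma> x t) = 1 \<and>
        dt \<gamma> x t =
          hodge_star \<sigma> (\<gamma> x t) (dx \<gamma> x t) (mean_curvature_vector \<sigma> (\<lambda>y. \<gamma> y t) x))"


definition parallel_matrix :: "real \<Rightarrow> real \<Rightarrow> real \<Rightarrow> real^4^4" where
  "parallel_matrix \<sigma> k1 k2 = vector [vector [0, - \<sigma>, 0, 0],
                                     vector [1, 0, - k1, - k2],
                                     vector [0, k1, 0, 0],
                                     vector [0, k2, 0, 0]]"

text \<open>
  \<open>g\<close> is a parallel frame along \<open>\<gamma>\<close> with principal curvatures \<open>k1\<close>, \<open>k2\<close>; the frame vectors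
  \<open>e\<^sub>0, e\<^sub>1, e\<^sub>2, e\<^sub>3\<close> are the columns \<open>1, 2, 3, 4\<close> of \<open>g\<close>.
\<close>

definition parallel_frame ::
  "real \<Rightarrow> real set \<Rightarrow> real set \<Rightarrow> (real \<Rightarrow> real \<Rightarrow> real^4) \<Rightarrow> (real \<Rightarrow> real \<Rightarrow> real^4^4) \<Rightarrow>
   (real \<Rightarrow> real \<Rightarrow> real) \<Rightarrow> (real \<Rightarrow> real \<Rightarrow> real) \<Rightarrow> bool" where
  "parallel_frame \<sigma> J T \<gamma> g k1 k2 \<longleftrightarrow>
     smooth_on (J \<times> T) g \<and>
     (\<forall>x\<in>J. \<forall>t\<in>T.
        g x t \<in> SO_group \<sigma> \<and>
        column 1 (g x t) = \<gamma> x t \<and>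
        column 2 (g x t) = dx \<gamma> x t \<and>
        matrix_inv (g x t) ** dx g x t = parallel_matrix \<sigma> (k1 x t) (k2 x t))"

text \<open>
  For each \<open>t\<close> a parallel frame along \<open>\<gamma>(\<cdot>, t)\<close> is unique only up to a rotation of \<open>(e\<^sub>2, e\<^sub>3)\<close> by
  an angle independent of \<open>x\<close>. Such a rotation by \<open>\<theta>(t)\<close> turns \<open>k = k1 + i k2\<close> into
  \<open>exp(-i \<theta>(t)) k\<close>, which changes the time evolution of \<open>k\<close>. Along the flow, any parallel frame
  satisfies \<open>\<langle>\<partial>\<^sub>t e\<^sub>2, e\<^sub>3\<rangle> = - |k|\<^sup>2 / 2 + c(t)\<close> (the entry in row 4 and column 3 of the matrix
  below), and the normalization \<open>c = 0\<close> fixes the time dependence of the rotation.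
\<close>

definition normal_rotation :: "real \<Rightarrow> real^4^4" where
  "normal_rotation \<theta> = vector [vector [1, 0, 0, 0],
                               vector [0, 1, 0, 0],
                               vector [0, 0, cos \<theta>, - sin \<theta>],
                               vector [0, 0, sin \<theta>, cos \<theta>]]"

definition time_normalized ::
  "real set \<Rightarrow> real set \<Rightarrow> (real \<Rightarrow> real \<Rightarrow> real^4^4) \<Rightarrow>
   (real \<Rightarrow> real \<Rightarrow> real) \<Rightarrow> (real \<Rightarrow> real \<Rightarrow> real) \<Rightarrow> bool" where
  "time_normalized J T g k1 k2 \<longleftrightarrow>
     (\<forall>x\<in>J. \<forall>t\<in>T.
        (matrix_inv (g x t) ** dt g x t) $ 4 $ 3 = - ((k1 x t)\<^sup>2 + (k2 x t)\<^sup>2) / 2)"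

definition solves_NLS :: "real \<Rightarrow> real set \<Rightarrow> real set \<Rightarrow> (real \<Rightarrow> real \<Rightarrow> complex) \<Rightarrow> bool" where
  "solves_NLS \<sigma> J T k \<longleftrightarrow>
     smooth_on (J \<times> T) k \<and>
     (\<forall>x\<in>J. \<forall>t\<in>T.
        dt k x t =
          \<i> * (dx (dx k) x t + of_real \<sigma> * k x t + 1/2 * of_real ((cmod (k x t))\<^sup>2) * k x t))"

end

theory Submission
  imports Defs
begin

text \<open>
  The proof is a zero curvature computation for the moving frame. Write the frame equations as
  \<open>g\<^sub>x = g P\<close> and \<open>g\<^sub>t = g Q\<close>. Here \<open>P\<close> is the matrix of a parallel frame, built from \<open>k\<^sub>1\<close> and
  \<open>k\<^sub>2\<close>, and equality of mixed partials gives the compatibility condition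
  \<open>P\<^sub>t + Q P = Q\<^sub>x + P Q\<close> (\<open>zero_curvature\<close>). The matrix \<open>Q\<close> lies in the Lie algebra of the isometry
  group, and the flow determines its first column: the mean curvature vector is
  \<open>k\<^sub>1 e\<^sub>2 + k\<^sub>2 e\<^sub>3\<close>, so \<open>\<gamma>\<^sub>t = k\<^sub>1 e\<^sub>3 - k\<^sub>2 e\<^sub>2\<close>. That the Hodge star may be computed in any oriented
  orthonormal frame holds because it is given by a determinant, like a cross product in dimension
  three (\<open>bform_rotated_normal_eq_det\<close>).

  The compatibility condition then yields everything else. Its first column gives the second column of
  \<open>Q\<close> as an \<open>x\<close>-derivative of the first. Its second column gives the evolution of \<open>k\<close>, namely
  \<open>k\<^sub>t = \<i> (k\<^sub>x\<^sub>x + \<sigma> k - u k)\<close> where \<open>u\<close>, the entry (4,3) of \<open>Q\<close>, is the angular speed of the normal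
  frame. Its entry (4,3) is \<open>u\<^sub>x = - (|k|\<^sup>2 / 2)\<^sub>x\<close> (\<open>curvature_evolution\<close>). For a time normalized frame
  \<open>u = - |k|\<^sup>2 / 2\<close>, and the evolution of \<open>k\<close> is the nonlinear Schroedinger equation.

  For an arbitrary parallel frame, \<open>u + |k|\<^sup>2 / 2\<close> depends on \<open>t\<close> only
  (\<open>defect_independent_of_x\<close>). Rotating the normal plane by an angle \<open>\<theta>(t)\<close> adds \<open>\<theta>'\<close> to \<open>u\<close> and keeps
  the frame parallel and \<open>|k|\<close> unchanged, so an antiderivative \<open>\<theta>\<close> of \<open>- (u + |k|\<^sup>2 / 2)\<close>
  produces a time normalized frame (\<open>rotated_frame_normalized\<close>), to which the first part applies.
\<close>

section \<open>Partial derivatives and smooth functions of two variables\<close>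

lemma has_vector_derivative_dx:
  assumes "(\<lambda>(x, t). f x t) differentiable at (x, t)"
  shows "((\<lambda>y. f y t) has_vector_derivative dx f x t) (at x)"
proof -
  have "(\<lambda>y. (y, t)) differentiable at x"
    by (intro differentiable_Pair) auto
  then have "((\<lambda>(x, t). f x t) \<circ> (\<lambda>y. (y, t))) differentiable at x"
    using assms by (intro differentiable_chain_at)
  then show ?thesis
    by (simp add: o_def dx_def vector_derivative_works)
qed

lemma has_vector_derivative_dt:
  assumes "(\<lambda>(x, t). f x t) differentiable at (x, t)"
  shows "((\<lambda>s. f x s) has_vector_derivative dt f x t) (at t)"
proof -
  have "(\<lambda>s. (x, s)) differentiable at t"
    by (intro differentiable_Pair) auto
  then have "((\<lambda>(x, t). f x t) \<circ> (\<lambda>s. (x, s))) differentiable at t"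
    using assms by (intro differentiable_chain_at)
  then show ?thesis
    by (simp add: o_def dt_def vector_derivative_works)
qed

lemma eventually_slices:
  fixes S :: "(real \<times> real) set"
  assumes "open S" "(x, t) \<in> S"
  shows "\<forall>\<^sub>F y in nhds x. (y, t) \<in> S" and "\<forall>\<^sub>F s in nhds t. (x, s) \<in> S"
proof -
  have "open ((\<lambda>y. (y, t)) -` S)" "open ((\<lambda>s. (x, s)) -` S)"
    by (auto intro!: open_vimage assms continuous_intros)
  then show "\<forall>\<^sub>F y in nhds x. (y, t) \<in> S" "\<forall>\<^sub>F s in nhds t. (x, s) \<in> S"
    using assms(2) by (auto dest: eventually_nhds_in_open)
qed

lemma dx_cong:
  assumes "open S" "(x, t) \<in> S" "\<And>y s. (y, s) \<in> S \<Longrightarrow> f y s = h y s"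
  shows "dx f x t = dx h x t"
  unfolding dx_def
proof (rule vector_derivative_cong_eq)
  show "\<forall>\<^sub>F y in nhds x. y \<in> UNIV \<longrightarrow> f y t = h y t"
    by (rule eventually_mono[OF eventually_slices(1)[OF assms(1,2)]]) (simp add: assms(3))
qed (use assms in auto)

lemma dt_cong:
  assumes "open S" "(x, t) \<in> S" "\<And>y s. (y, s) \<in> S \<Longrightarrow> f y s = h y s"
  shows "dt f x t = dt h x t"
  unfolding dt_def
proof (rule vector_derivative_cong_eq)
  show "\<forall>\<^sub>F s in nhds t. s \<in> UNIV \<longrightarrow> f x s = h x s"
    by (rule eventually_mono[OF eventually_slices(2)[OF assms(1,2)]]) (simp add: assms(3))
qed (use assms in auto)

lemma Cn_on_cong:
  assumes "open S" "\<And>x t. (x, t) \<in> S \<Longrightarrow> f x t = h x t" "Cn_on n S f"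
  shows "Cn_on n S h"
  using assms(2,3)
proof (induction n arbitrary: f h)
  case 0
  have "continuous_on S (\<lambda>(x, t). f x t) \<longleftrightarrow> continuous_on S (\<lambda>(x, t). h x t)"
    by (rule continuous_on_cong) (auto simp: 0)
  then show ?case using 0 by simp
next
  case (Suc n)
  have "(\<lambda>(x, t). h x t) differentiable at p" if p: "p \<in> S" for p
  proof -
    obtain D where D: "((\<lambda>(x, t). f x t) has_derivative D) (at p)"
      using Suc.prems(2) p unfolding Cn_on.simps(2) differentiable_def by blast
    have "((\<lambda>(x, t). h x t) has_derivative D) (at p)"
      by (rule has_derivative_transform_within_open[OF D assms(1) p]) (auto simp: Suc.prems(1))
    then show ?thesis by (auto simp: differentiable_def)
  qed
  moreover have "Cn_on n S (dx h)"
    by (rule Suc.IH[OF dx_cong[OF assms(1) _ Suc.prems(1)]]) (use Suc.prems(2) in simp_all)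
  moreover have "Cn_on n S (dt h)"
    by (rule Suc.IH[OF dt_cong[OF assms(1) _ Suc.prems(1)]]) (use Suc.prems(2) in simp_all)
  ultimately show ?case by simp
qed

lemma Cn_on_const: "Cn_on n S (\<lambda>x t. c)"
proof (induction n arbitrary: c)
  case (Suc n)
  have "dx (\<lambda>x t. c) = (\<lambda>x t. 0)" "dt (\<lambda>x t. c) = (\<lambda>x t. 0)"
    by (auto simp: dx_def dt_def fun_eq_iff)
  with Suc show ?case by (simp add: case_prod_beta')
qed (simp add: case_prod_beta')

lemma Cn_on_SucD:
  assumes "Cn_on (Suc n) S f" shows "Cn_on n S f"
  using assms
proof (induction n arbitrary: f)
  case 0
  then show ?case
    unfolding Cn_on.simps
    by (intro differentiable_imp_continuous_on) (auto simp only: differentiable_on_def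
        intro: differentiable_at_withinI)
next
  case (Suc n)
  then have "Cn_on n S (dx f)" "Cn_on n S (dt f)"
    unfolding Cn_on.simps(2)[of "Suc n"] by blast+
  with Suc.prems show ?case
    unfolding Cn_on.simps(2) by blast
qed

lemma partials_add:
  assumes "(\<lambda>(x, t). f x t) differentiable at (x, t)" "(\<lambda>(x, t). h x t) differentiable at (x, t)"
  shows "dx (\<lambda>x t. f x t + h x t) x t = dx f x t + dx h x t"
    and "dt (\<lambda>x t. f x t + h x t) x t = dt f x t + dt h x t"
  unfolding dx_def[of "\<lambda>x t. f x t + h x t"] dt_def[of "\<lambda>x t. f x t + h x t"]
  by (intro vector_derivative_at has_vector_derivative_add
      has_vector_derivative_dx has_vector_derivative_dt assms)+

lemma Cn_on_add:
  assumes "open S" "Cn_on n S f" "Cn_on n S h"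
  shows "Cn_on n S (\<lambda>x t. f x t + h x t)"
  using assms(2,3)
proof (induction n arbitrary: f h)
  case 0
  then show ?case by (auto simp: case_prod_beta' intro!: continuous_intros)
next
  case (Suc n)
  have "Cn_on n S (\<lambda>x t. dx f x t + dx h x t)" "Cn_on n S (\<lambda>x t. dt f x t + dt h x t)"
    using Suc by auto
  note D = this
  have "Cn_on n S (dx (\<lambda>x t. f x t + h x t))"
    by (rule Cn_on_cong[OF assms(1) _ D(1)])
      (use Suc.prems in \<open>simp add: partials_add(1)\<close>)
  moreover have "Cn_on n S (dt (\<lambda>x t. f x t + h x t))"
    by (rule Cn_on_cong[OF assms(1) _ D(2)])
      (use Suc.prems in \<open>simp add: partials_add(2)\<close>)
  moreover have "(\<lambda>(x, t). f x t + h x t) differentiable at p" if "p \<in> S" for p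
    using Suc.prems that by (auto simp: case_prod_beta' intro!: differentiable_add)
  ultimately show ?case by simp
qed

lemma partials_linear:
  assumes "bounded_linear L" "(\<lambda>(x, t). f x t) differentiable at (x, t)"
  shows "dx (\<lambda>x t. L (f x t)) x t = L (dx f x t)"
    and "dt (\<lambda>x t. L (f x t)) x t = L (dt f x t)"
  unfolding dx_def[of "\<lambda>x t. L (f x t)"] dt_def[of "\<lambda>x t. L (f x t)"]
  by (intro vector_derivative_at bounded_linear.has_vector_derivative[OF assms(1)]
      has_vector_derivative_dx has_vector_derivative_dt assms(2))+

lemma Cn_on_linear:
  assumes "open S" "bounded_linear L" "Cn_on n S f"
  shows "Cn_on n S (\<lambda>x t. L (f x t))"
  using assms(3)
proof (induction n arbitrary: f)
  case 0
  then show ?case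
    by (auto simp: case_prod_beta' intro!: bounded_linear.continuous_on[OF assms(2)])
next
  case (Suc n)
  have "Cn_on n S (\<lambda>x t. L (dx f x t))" "Cn_on n S (\<lambda>x t. L (dt f x t))"
    using Suc by auto
  note D = this
  have "Cn_on n S (dx (\<lambda>x t. L (f x t)))"
    by (rule Cn_on_cong[OF assms(1) _ D(1)])
      (use Suc.prems in \<open>simp add: partials_linear(1)[OF assms(2)]\<close>)
  moreover have "Cn_on n S (dt (\<lambda>x t. L (f x t)))"
    by (rule Cn_on_cong[OF assms(1) _ D(2)])
      (use Suc.prems in \<open>simp add: partials_linear(2)[OF assms(2)]\<close>)
  moreover have "(\<lambda>(x, t). L (f x t)) differentiable at p" if "p \<in> S" for p
    using Suc.prems that bounded_linear.has_derivative[OF assms(2)]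
    unfolding Cn_on.simps case_prod_beta' differentiable_def by blast
  ultimately show ?case by simp
qed

lemma partials_bilinear:
  assumes B: "bounded_bilinear B"
    and "(\<lambda>(x, t). f x t) differentiable at (x, t)" "(\<lambda>(x, t). h x t) differentiable at (x, t)"
  shows "dx (\<lambda>x t. B (f x t) (h x t)) x t = B (f x t) (dx h x t) + B (dx f x t) (h x t)"
    and "dt (\<lambda>x t. B (f x t) (h x t)) x t = B (f x t) (dt h x t) + B (dt f x t) (h x t)"
  unfolding dx_def[of "\<lambda>x t. B (f x t) (h x t)"] dt_def[of "\<lambda>x t. B (f x t) (h x t)"]
  by (intro vector_derivative_at bounded_bilinear.has_vector_derivative[OF B]
      has_vector_derivative_dx has_vector_derivative_dt assms(2,3))+

text \<open>
  Every factor in the product rule is of class \<open>C\<^sup>n\<close> when the two functions are of class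
  \<open>C\<^sup>n\<^sup>+\<^sup>1\<close>; the undifferentiated factors lose one order, which is harmless for the induction.
\<close>

lemma Cn_on_bilinear:
  assumes B: "bounded_bilinear B" and "open S" "Cn_on n S f" "Cn_on n S h"
  shows "Cn_on n S (\<lambda>x t. B (f x t) (h x t))"
  using assms(3,4)
proof (induction n arbitrary: f h)
  case 0
  then show ?case by (auto simp: case_prod_beta' intro!: bounded_bilinear.continuous_on[OF B])
next
  case (Suc n)
  have "Cn_on n S f" "Cn_on n S h"
    using Suc.prems by (auto intro: Cn_on_SucD)
  then have "Cn_on n S (\<lambda>x t. B (f x t) (dx h x t) + B (dx f x t) (h x t))"
    "Cn_on n S (\<lambda>x t. B (f x t) (dt h x t) + B (dt f x t) (h x t))"
    using Suc by (auto intro!: Cn_on_add assms(2))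
  note D = this
  have "Cn_on n S (dx (\<lambda>x t. B (f x t) (h x t)))"
    by (rule Cn_on_cong[OF assms(2) _ D(1)])
      (use Suc.prems in \<open>simp add: partials_bilinear(1)[OF B]\<close>)
  moreover have "Cn_on n S (dt (\<lambda>x t. B (f x t) (h x t)))"
    by (rule Cn_on_cong[OF assms(2) _ D(2)])
      (use Suc.prems in \<open>simp add: partials_bilinear(2)[OF B]\<close>)
  moreover have "(\<lambda>(x, t).B (f x t) (h x t)) differentiable at p" if "p \<in> S" for p
    using Suc.prems that bounded_bilinear.FDERIV[OF B]
    unfolding Cn_on.simps case_prod_beta' differentiable_def by blast
  ultimately show ?case by simp
qed

lemma smooth_on_differentiable:
  "smooth_on S f \<Longrightarrow> p \<in> S \<Longrightarrow> (\<lambda>(x, t). f x t) differentiable at p"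
  unfolding smooth_on_def by (metis Cn_on.simps(2))

lemma smooth_on_dx: "smooth_on S f \<Longrightarrow> smooth_on S (dx f)"
  and smooth_on_dt: "smooth_on S f \<Longrightarrow> smooth_on S (dt f)"
  unfolding smooth_on_def by (metis Cn_on.simps(2))+

lemma smooth_on_continuous: "smooth_on S f \<Longrightarrow> continuous_on S (\<lambda>(x, t). f x t)"
  unfolding smooth_on_def by (metis Cn_on.simps(1))

text \<open>
  By the fundamental theorem of calculus, \<open>f y s - f y a\<close> is the integral of \<open>dt f y\<close> over
  \<open>[a, s]\<close>. Differentiating under the integral sign in \<open>y\<close> expresses \<open>dx f x s - dx f x a\<close> as the
  integral of \<open>dx (dt f) x\<close>, which is continuous; the derivative of that identity in \<open>s\<close> is the claim.
\<close>

lemma mixed_partials_commute: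
  fixes f :: "real \<Rightarrow> real \<Rightarrow> 'a::euclidean_space"
  assumes J: "open J" "is_interval J" and T: "open T" "is_interval T"
    and f: "smooth_on (J \<times> T) f" and x: "x \<in> J" and t: "t \<in> T"
  shows "dx (dt f) x t = dt (dx f) x t"
proof -
  note d = smooth_on_differentiable[OF f] smooth_on_differentiable[OF smooth_on_dx[OF f]]
     smooth_on_differentiable[OF smooth_on_dt[OF f]]
  obtain e where e: "e > 0" "cball t e \<subseteq> T"
    using T(1) t open_contains_cball by blast
  define a b where "a = t - e" and "b = t + e"
  have ab: "a < t" "t < b" "{a..b} \<subseteq> T"
    using e by (auto simp: a_def b_def cball_eq_atLeastAtMost)
  have T': "s \<in> T" if "a \<le> s" "s \<le> b" for s using that ab by auto
  have cont: "continuous_on (J \<times> {a..b}) (\<lambda>(x, t). dt f x t)"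
    "continuous_on (J \<times> {a..b}) (\<lambda>(x, t). dx (dt f) x t)"
    using smooth_on_continuous[OF smooth_on_dt[OF f]] ab
      smooth_on_continuous[OF smooth_on_dx[OF smooth_on_dt[OF f]]]
    by (auto elim!: continuous_on_subset)
  have slice: "continuous_on {a..b} (dt f y)" "continuous_on {a..b} (dx (dt f) y)"
    if "y \<in> J" for y
  proof -
    have "continuous_on {a..b} (Pair y)"
      by (rule continuous_on_Pair[OF continuous_on_const continuous_on_id])
    from continuous_on_compose2[OF cont(1) this] continuous_on_compose2[OF cont(2) this] that
    show "continuous_on {a..b} (dt f y)" "continuous_on {a..b} (dx (dt f) y)"
      by auto
  qed
  have key: "dx f x s - dx f x a = integral {a..s} (\<lambda>r. dx (dt f) x r)" if s: "s \<in> {a<..<b}" for s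
  proof -
    \<comment> \<open>differentiation under the integral sign\<close>
    have "((\<lambda>y. integral (cbox a s) (dt f y)) has_vector_derivative
        integral (cbox a s) (dx (dt f) x)) (at x within J)"
    proof (rule leibniz_rule_vector_derivative)
      show "((\<lambda>x. dt f x r) has_vector_derivative dx (dt f) y r) (at y within J)"
        if "y \<in> J" "r \<in> cbox a s" for y r
        using that s T' by (auto intro!: has_vector_derivative_at_within has_vector_derivative_dx d)
      show "dt f y integrable_on cbox a s" if "y \<in> J" for y
        using slice[OF that] s by (intro integrable_continuous) (auto elim: continuous_on_subset)
      show "continuous_on (J \<times> cbox a s) (\<lambda>(x, t). dx (dt f) x t)"
        by (rule continuous_on_subset[OF cont(2)]) (use s in auto)
    qed (use x J is_interval_convex in auto)
    then have "((\<lambda>y. integral (cbox a s) (dt f y)) has_vector_derivative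
        integral (cbox a s) (dx (dt f) x)) (at x)"
      using at_within_open[OF x J(1)] by simp
    moreover have "integral (cbox a s) (dt f y) = f y s - f y a" if "y \<in> J" for y
    proof -
      have "(dt f y has_integral f y s - f y a) {a..s}"
        by (rule fundamental_theorem_of_calculus)
          (use that s T' in \<open>auto intro!: has_vector_derivative_at_within has_vector_derivative_dt d\<close>)
      then show ?thesis by (simp add: integral_unique)
    qed
    ultimately have "((\<lambda>y. f y s - f y a) has_vector_derivative
        integral (cbox a s) (dx (dt f) x)) (at x)"
      using has_vector_derivative_transform_within_open[OF _ J(1) x] by fastforce
    moreover have "((\<lambda>y. f y s - f y a) has_vector_derivative dx f x s - dx f x a) (at x)"
      using s x T' by (intro has_vector_derivative_diff has_vector_derivative_dx d) auto
    ultimately show ?thesis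
      by (metis cbox_interval vector_derivative_at)
  qed
  have "((\<lambda>s. integral {a..s} (\<lambda>r. dx (dt f) x r)) has_vector_derivative dx (dt f) x t)
      (at t within {a..b})"
    by (rule integral_has_vector_derivative) (use slice x ab in auto)
  then have "((\<lambda>s. integral {a..s} (\<lambda>r. dx (dt f) x r)) has_vector_derivative dx (dt f) x t) (at t)"
    using ab by (simp add: at_within_Icc_at)
  then have "((\<lambda>s. dx f x s - dx f x a) has_vector_derivative dx (dt f) x t) (at t)"
    by (rule has_vector_derivative_transform_within_open[where S="{a<..<b}"])
      (use ab in \<open>auto simp: key\<close>)
  moreover have "((\<lambda>s. dx f x s - dx f x a) has_vector_derivative dt (dx f) x t - 0) (at t)"
    using x t by (intro has_vector_derivative_diff has_vector_derivative_dt d) auto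
  ultimately show ?thesis
    by (metis diff_zero vector_derivative_at)
qed

lemma smooth_on_cong:
  assumes "open S" "\<And>x t. (x, t) \<in> S \<Longrightarrow> f x t = h x t" "smooth_on S f"
  shows "smooth_on S h"
  using assms Cn_on_cong[of S f h] unfolding smooth_on_def by blast

lemma smooth_on_const: "smooth_on S (\<lambda>x t. c)"
  by (simp add: smooth_on_def Cn_on_const)

lemma smooth_on_add:
  "open S \<Longrightarrow> smooth_on S f \<Longrightarrow> smooth_on S h \<Longrightarrow> smooth_on S (\<lambda>x t. f x t + h x t)"
  by (simp add: smooth_on_def Cn_on_add)

lemma smooth_on_linear:
  "open S \<Longrightarrow> bounded_linear L \<Longrightarrow> smooth_on S f \<Longrightarrow> smooth_on S (\<lambda>x t. L (f x t))"
  by (simp add: smooth_on_def Cn_on_linear)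

lemma smooth_on_bilinear:
  "open S \<Longrightarrow> bounded_bilinear B \<Longrightarrow> smooth_on S f \<Longrightarrow> smooth_on S h \<Longrightarrow>
    smooth_on S (\<lambda>x t. B (f x t) (h x t))"
  by (simp add: smooth_on_def Cn_on_bilinear)

section \<open>Matrices of size four\<close>

lemma vector_4 [simp]:
  "(vector [a, b, c, d] :: 'a::zero^4) $ 1 = a"
  "(vector [a, b, c, d] :: 'a::zero^4) $ 2 = b"
  "(vector [a, b, c, d] :: 'a::zero^4) $ 3 = c"
  "(vector [a, b, c, d] :: 'a::zero^4) $ 4 = d"
  by (simp_all add: vector_def)

lemma det_4:
  "det (A::'a::comm_ring_1^4^4) =
    A$1$1 * (A$2$2 * (A$3$3 * A$4$4 - A$3$4 * A$4$3) - A$2$3 * (A$3$2 * A$4$4 - A$3$4 * A$4$2)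
      + A$2$4 * (A$3$2 * A$4$3 - A$3$3 * A$4$2))
  - A$1$2 * (A$2$1 * (A$3$3 * A$4$4 - A$3$4 * A$4$3) - A$2$3 * (A$3$1 * A$4$4 - A$3$4 * A$4$1)
      + A$2$4 * (A$3$1 * A$4$3 - A$3$3 * A$4$1))
  + A$1$3 * (A$2$1 * (A$3$2 * A$4$4 - A$3$4 * A$4$2) - A$2$2 * (A$3$1 * A$4$4 - A$3$4 * A$4$1)
      + A$2$4 * (A$3$1 * A$4$2 - A$3$2 * A$4$1))
  - A$1$4 * (A$2$1 * (A$3$2 * A$4$3 - A$3$3 * A$4$2) - A$2$2 * (A$3$1 * A$4$3 - A$3$3 * A$4$1)
      + A$2$3 * (A$3$1 * A$4$2 - A$3$2 * A$4$1))"
proof -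
  have f1: "finite {2::4, 3, 4}" "1 \<notin> {2::4, 3, 4}" by auto
  have f2: "finite {3::4, 4}" "2 \<notin> {3::4, 4}" by auto
  have f3: "finite {4::4}" "3 \<notin> {4::4}" by auto
  show ?thesis
    unfolding det_def UNIV_4
    unfolding sum_over_permutations_insert[OF f1] sum_over_permutations_insert[OF f2]
      sum_over_permutations_insert[OF f3] permutes_sing
    by (simp add: sign_swap_id permutation_swap_id sign_compose permutation_compose sign_id
        swap_id_eq algebra_simps)
qed

lemma matrix_eq_4:
  fixes A B :: "'a^4^4"
  shows "A = B \<longleftrightarrow> A$1$1 = B$1$1 \<and> A$1$2 = B$1$2 \<and> A$1$3 = B$1$3 \<and> A$1$4 = B$1$4
    \<and> A$2$1 = B$2$1 \<and> A$2$2 = B$2$2 \<and> A$2$3 = B$2$3 \<and> A$2$4 = B$2$4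
    \<and> A$3$1 = B$3$1 \<and> A$3$2 = B$3$2 \<and> A$3$3 = B$3$3 \<and> A$3$4 = B$3$4
    \<and> A$4$1 = B$4$1 \<and> A$4$2 = B$4$2 \<and> A$4$3 = B$4$3 \<and> A$4$4 = B$4$4"
  by (auto simp: vec_eq_iff forall_4)

lemma matrix_mult_4:
  fixes A B :: "'a::semiring_1^4^4"
  shows "(A ** B) $ i $ j = A$i$1 * B$1$j + A$i$2 * B$2$j + A$i$3 * B$3$j + A$i$4 * B$4$j"
  by (simp add: matrix_matrix_mult_def sum_4)

lemma transpose_nth: "transpose A $ i $ j = A $ j $ i"
  by (simp add: transpose_def)

lemma bounded_bilinear_matrix_mult: "bounded_bilinear ((**) :: real^4^4 \<Rightarrow> real^4^4 \<Rightarrow> real^4^4)"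
  unfolding bilinear_conv_bounded_bilinear[symmetric] bilinear_def
  by (auto intro!: linearI simp: vec_eq_iff matrix_matrix_mult_def sum_distrib_left sum.distrib
      algebra_simps)

lemma bounded_linear_transpose: "bounded_linear (transpose :: real^4^4 \<Rightarrow> real^4^4)"
  by (auto intro!: linearI simp: linear_conv_bounded_linear[symmetric] transpose_def vec_eq_iff)

lemma bounded_linear_column: "bounded_linear (column j :: real^4^4 \<Rightarrow> real^4)"
  by (auto intro!: linearI simp: linear_conv_bounded_linear[symmetric] column_def vec_eq_iff)

lemma bounded_linear_entry: "bounded_linear (\<lambda>A :: real^4^4. A $ i $ j)"
  by (auto intro!: linearI simp: linear_conv_bounded_linear[symmetric])

lemma matrix_inv_unique:
  fixes A B :: "real^4^4"
  assumes "A ** B = mat 1" "B ** A = mat 1"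
  shows "matrix_inv A = B"
proof -
  have "A ** matrix_inv A = mat 1 \<and> matrix_inv A ** A = mat 1"
    unfolding matrix_inv_def by (rule someI[of _ B]) (use assms in auto)
  then show ?thesis
    by (metis assms(2) matrix_mul_assoc matrix_mul_lid matrix_mul_rid)
qed

lemma column_matrix_mult: "column j (A ** B) = A *v column j B"
  by (simp add: vec_eq_iff column_def matrix_matrix_mult_def matrix_vector_mult_def)

lemma frame_matrix_mult_vec:
  "frame_matrix p v n2 n3 *v z = z$1 *\<^sub>R p + z$2 *\<^sub>R v + z$3 *\<^sub>R n2 + z$4 *\<^sub>R n3"
  by (simp add: vec_eq_iff frame_matrix_def matrix_vector_mult_def sum_4 transpose_nth algebra_simps)

lemma frame_matrix_columns: "frame_matrix (column 1 g) (column 2 g) (column 3 g) (column 4 g) = g"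
  by (simp add: matrix_eq_4 frame_matrix_def transpose_nth column_def)

section \<open>The groups SO(4) and SO(1,3) and the Hodge star\<close>

lemma bform_gram: "bform \<sigma> v w = v \<bullet> (gram \<sigma> *v w)"
  by (simp add: bform_def gram_def inner_vec_def matrix_vector_mult_def sum_4)

lemma bform_SO_group:
  assumes "g \<in> SO_group \<sigma>"
  shows "bform \<sigma> (g *v v) (g *v w) = bform \<sigma> v w"
proof -
  have "bform \<sigma> (g *v v) (g *v w) = v \<bullet> ((transpose g ** gram \<sigma> ** g) *v w)"
    by (simp add: bform_gram matrix_vector_mul_assoc[symmetric])
      (metis dot_lmul_matrix inner_commute transpose_matrix_vector)
  then show ?thesis using assms by (simp add: SO_group_def bform_gram)
qed

lemma SO_group_inverse:
  assumes "\<sigma> = 1 \<or> \<sigma> = - 1" "g \<in> SO_group \<sigma>"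
  shows "matrix_inv g = gram \<sigma> ** transpose g ** gram \<sigma>"
    and "matrix_inv g ** g = mat 1" and "g ** matrix_inv g = mat 1"
proof -
  let ?h = "gram \<sigma> ** transpose g ** gram \<sigma>"
  have "gram \<sigma> ** gram \<sigma> = mat 1"
    using assms(1) by (auto simp: matrix_eq_4 matrix_mult_4 gram_def mat_def)
  then have "?h ** g = mat 1"
    using assms(2) by (simp add: SO_group_def matrix_mul_assoc[symmetric])
  moreover from this have "g ** ?h = mat 1"
    by (simp add: matrix_left_right_inverse)
  moreover from calculation show "matrix_inv g = ?h"
    by (intro matrix_inv_unique)
  ultimately show "matrix_inv g ** g = mat 1" "g ** matrix_inv g = mat 1"
    by auto
qed

lemma bform_nondegenerate:
  assumes "\<sigma> = 1 \<or> \<sigma> = - 1" "\<And>z. bform \<sigma> v z = bform \<sigma> w z"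
  shows "v = w"
  using assms(2)[of "axis 1 1"] assms(2)[of "axis 2 1"] assms(2)[of "axis 3 1"]
    assms(2)[of "axis 4 1"] assms(1)
  by (auto simp: bform_def axis_def vec_eq_iff forall_4)

text \<open>
  The rotated vector represents the linear form \<open>z \<mapsto> det (p, v, n, z)\<close> with respect to the
  metric, as a cross product does. The right-hand side mentions the normal vector \<open>n\<close> but not the
  basis \<open>(n2, n3)\<close>, so the rotation by \<open>\<pi>/2\<close> is intrinsic. In the coordinates of the frame both
  sides are \<open>a * y$4 - b * y$3\<close>, where \<open>y\<close> is the coordinate vector of \<open>z\<close>.
\<close>

lemma bform_rotated_normal_eq_det:
  assumes "\<sigma> = 1 \<or> \<sigma> = - 1" "frame_matrix p v n2 n3 \<in> SO_group \<sigma>"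
  shows "bform \<sigma> (a *\<^sub>R n3 - b *\<^sub>R n2) z = det (frame_matrix p v (a *\<^sub>R n2 + b *\<^sub>R n3) z)"
proof -
  let ?F = "frame_matrix p v n2 n3"
  define y where "y = matrix_inv ?F *v z"
  have z: "z = ?F *v y"
    by (simp add: y_def matrix_vector_mul_assoc SO_group_inverse(3)[OF assms])
  have w: "a *\<^sub>R n3 - b *\<^sub>R n2 = ?F *v vector [0, 0, - b, a]"
    by (simp add: frame_matrix_mult_vec)
  \<comment> \<open>the coordinates of \<open>(p, v, n, z)\<close> in the frame, column by column\<close>
  let ?C = "frame_matrix (axis 1 1) (axis 2 1) (vector [0, 0, a, b]) y"
  have "frame_matrix p v (a *\<^sub>R n2 + b *\<^sub>R n3) z = ?F ** ?C"
    by (simp add: z frame_matrix_mult_vec)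
      (simp add: matrix_eq_4 matrix_mult_4 frame_matrix_def transpose_nth axis_def algebra_simps)
  moreover have "det ?C = a * y$4 - b * y$3"
    by (simp add: det_4 frame_matrix_def transpose_nth axis_def)
  ultimately have "det (frame_matrix p v (a *\<^sub>R n2 + b *\<^sub>R n3) z) = a * y$4 - b * y$3"
    using assms(2) by (simp add: det_mul SO_group_def)
  moreover have "bform \<sigma> (a *\<^sub>R n3 - b *\<^sub>R n2) z = a * y$4 - b * y$3"
    unfolding w z bform_SO_group[OF assms(2)] by (simp add: bform_def)
  ultimately show ?thesis by simp
qed

text \<open>
  Any candidate for the definite description has the same metric pairing with all vectors, by
  the determinant formula above, so nondegeneracy of the metric makes it unique.
\<close>

lemma hodge_star_eq:
  assumes "\<sigma> = 1 \<or> \<sigma> = - 1" "frame_matrix p v n2 n3 \<in> SO_group \<sigma>"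
  shows "hodge_star \<sigma> p v (a *\<^sub>R n2 + b *\<^sub>R n3) = a *\<^sub>R n3 - b *\<^sub>R n2"
  unfolding hodge_star_def
proof (rule the_equality)
  fix w
  assume "\<exists>m2 m3 c d. frame_matrix p v m2 m3 \<in> SO_group \<sigma> \<and>
      a *\<^sub>R n2 + b *\<^sub>R n3 = c *\<^sub>R m2 + d *\<^sub>R m3 \<and> w = c *\<^sub>R m3 - d *\<^sub>R m2"
  then show "w = a *\<^sub>R n3 - b *\<^sub>R n2"
    using bform_rotated_normal_eq_det[OF assms(1)] assms(2)
    by (intro bform_nondegenerate[OF assms(1)]) metis
qed (use assms(2) in blast)

section \<open>Rotations of the normal plane\<close>

definition rotation_generator :: "real^4^4" where
  "rotation_generator = vector [vector [0, 0, 0, 0],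
                                vector [0, 0, 0, 0],
                                vector [0, 0, 0, - 1],
                                vector [0, 0, 1, 0]]"

lemma has_vector_derivative_normal_rotation:
  "(normal_rotation has_vector_derivative normal_rotation \<phi> ** rotation_generator) (at \<phi>)"
proof -
  \<comment> \<open>\<open>?E\<close> and \<open>?D\<close> project onto the span of \<open>e\<^sub>0, e\<^sub>1\<close> and onto the normal plane\<close>
  let ?D = "vector [vector [0, 0, 0, 0], vector [0, 0, 0, 0],
      vector [0, 0, 1, 0], vector [0, 0, 0, 1]] :: real^4^4"
  let ?E = "vector [vector [1, 0, 0, 0], vector [0, 1, 0, 0],
      vector [0, 0, 0, 0], vector [0, 0, 0, 0]] :: real^4^4"
  have "((\<lambda>\<phi>. ?E + cos \<phi> *\<^sub>R ?D + sin \<phi> *\<^sub>R rotation_generator) has_vector_derivative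
      - sin \<phi> *\<^sub>R ?D + cos \<phi> *\<^sub>R rotation_generator) (at \<phi>)"
    by (auto intro!: derivative_eq_intros)
  moreover have "(\<lambda>\<phi>. ?E + cos \<phi> *\<^sub>R ?D + sin \<phi> *\<^sub>R rotation_generator) = normal_rotation"
    by (simp add: fun_eq_iff matrix_eq_4 normal_rotation_def rotation_generator_def)
  moreover have "- sin \<phi> *\<^sub>R ?D + cos \<phi> *\<^sub>R rotation_generator =
      normal_rotation \<phi> ** rotation_generator"
    by (simp add: matrix_eq_4 matrix_mult_4 normal_rotation_def rotation_generator_def)
  ultimately show ?thesis by simp
qed

lemma dx_normal_rotation: "dx (\<lambda>x t. normal_rotation (\<theta> t)) = (\<lambda>x t. 0)"
  by (simp add: dx_def fun_eq_iff)

lemma dt_normal_rotation: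
  assumes "(\<theta> has_vector_derivative c) (at t)"
  shows "dt (\<lambda>x t. normal_rotation (\<theta> t)) x t = normal_rotation (\<theta> t) ** (c *\<^sub>R rotation_generator)"
proof -
  have "((normal_rotation \<circ> \<theta>) has_vector_derivative
      c *\<^sub>R (normal_rotation (\<theta> t) ** rotation_generator)) (at t)"
    by (rule vector_diff_chain_at[OF assms has_vector_derivative_normal_rotation])
  moreover have "c *\<^sub>R (normal_rotation (\<theta> t) ** rotation_generator) =
      normal_rotation (\<theta> t) ** (c *\<^sub>R rotation_generator)"
    by (rule bounded_bilinear.scaleR_right[OF bounded_bilinear_matrix_mult, symmetric])
  ultimately show ?thesis
    by (simp add: dt_def o_def vector_derivative_at)
qed

text \<open>
  The function solves a linear differential equation in \<open>t\<close> with smooth coefficients and does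
  not depend on \<open>x\<close>. Its derivatives of order one are therefore products of itself with smooth
  functions, and each order of differentiability gives the next one.
\<close>

lemma smooth_on_normal_rotation:
  assumes "open S" "smooth_on S c"
    and \<theta>: "\<And>x t. (x, t) \<in> S \<Longrightarrow> (\<theta> has_vector_derivative c x t) (at t)"
  shows "smooth_on S (\<lambda>x t. normal_rotation (\<theta> t))"
proof -
  have diff: "(\<lambda>(x, t). normal_rotation (\<theta> t)) differentiable at p" if "p \<in> S" for p
  proof -
    have "\<theta> differentiable at (snd p)"
      using \<theta>[of "fst p" "snd p"] that by (auto intro: differentiableI_vector)
    moreover have "normal_rotation differentiable at (\<theta> (snd p))"
      using has_vector_derivative_normal_rotation differentiableI_vector by blast
    moreover have "(snd :: real \<times> real \<Rightarrow> real) differentiable at p"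
      by (intro bounded_linear_imp_differentiable bounded_linear_snd)
    ultimately show ?thesis
      unfolding case_prod_beta'
      using differentiable_compose[of normal_rotation "\<lambda>p. \<theta> (snd p)" p]
        differentiable_compose[of \<theta> snd p] by auto
  qed
  have "Cn_on n S (\<lambda>x t. normal_rotation (\<theta> t))" for n
  proof (induction n)
    case 0
    then show ?case
      unfolding Cn_on.simps
      using diff differentiable_at_withinI differentiable_on_def
      by (blast intro: differentiable_imp_continuous_on)
  next
    case (Suc n)
    have "Cn_on n S (\<lambda>x t. c x t *\<^sub>R rotation_generator)"
      using smooth_on_linear[OF assms(1) bounded_linear_scaleR_left assms(2)]
      unfolding smooth_on_def by blast
    with Suc have "Cn_on n S (\<lambda>x t. normal_rotation (\<theta> t) ** (c x t *\<^sub>R rotation_generator))"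
      by (intro Cn_on_bilinear[OF bounded_bilinear_matrix_mult assms(1)])
    then have "Cn_on n S (dt (\<lambda>x t. normal_rotation (\<theta> t)))"
      by (rule Cn_on_cong[OF assms(1), rotated]) (simp add: dt_normal_rotation[OF \<theta>])
    with diff show ?case
      by (simp add: dx_normal_rotation Cn_on_const)
  qed
  then show ?thesis by (simp add: smooth_on_def)
qed

lemma normal_rotation_mult_inverse:
  "transpose (normal_rotation \<phi>) ** normal_rotation \<phi> = mat 1"
  "normal_rotation \<phi> ** transpose (normal_rotation \<phi>) = mat 1"
  by (simp_all add: matrix_eq_4 matrix_mult_4 transpose_nth normal_rotation_def mat_def
      power2_eq_square[symmetric])

lemma SO_group_normal_rotation:
  assumes "g \<in> SO_group \<sigma>"
  shows "g ** normal_rotation \<phi> \<in> SO_group \<sigma>"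
proof -
  let ?R = "normal_rotation \<phi>"
  have "transpose (g ** ?R) ** gram \<sigma> ** (g ** ?R) =
      transpose ?R ** (transpose g ** gram \<sigma> ** g) ** ?R"
    by (simp add: matrix_transpose_mul matrix_mul_assoc)
  also have "\<dots> = transpose ?R ** gram \<sigma> ** ?R"
    using assms by (simp add: SO_group_def)
  also have "\<dots> = gram \<sigma>"
    by (simp add: matrix_eq_4 matrix_mult_4 transpose_nth normal_rotation_def gram_def
        power2_eq_square[symmetric])
  finally have "transpose (g ** ?R) ** gram \<sigma> ** (g ** ?R) = gram \<sigma>" .
  moreover have "det ?R = 1"
    by (simp add: det_4 normal_rotation_def power2_eq_square[symmetric])
  ultimately show ?thesis
    using assms by (simp add: SO_group_def det_mul)
qed

text \<open>
  \<open>T\<close> is the interval between its extended real infimum and supremum; this makes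
  the library theorem on extended intervals applicable also when \<open>T\<close> is unbounded.
\<close>

lemma antiderivative_on_open_interval:
  fixes f :: "real \<Rightarrow> real"
  assumes "open T" "is_interval T" "continuous_on T f"
  shows "\<exists>F. \<forall>t\<in>T. (F has_vector_derivative f t) (at t)"
proof (cases "T = {}")
  case False
  define a b where "a = (INF t\<in>T. ereal t)" and "b = (SUP t\<in>T. ereal t)"
  have T: "t \<in> T" if t: "a < ereal t" "ereal t < b" for t
  proof -
    obtain r s where "r \<in> T" "s \<in> T" "r < t" "t < s"
      using t unfolding a_def b_def INF_less_iff less_SUP_iff less_ereal.simps(1) by blast
    then show ?thesis
      using assms(2) unfolding is_interval_1 by (metis less_imp_le)
  qed
  have ab: "a < ereal t \<and> ereal t < b" if t: "t \<in> T" for t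
  proof -
    obtain e where e: "e > 0" "cball t e \<subseteq> T"
      using assms(1) t open_contains_cball by blast
    then have "t - e \<in> T" "t + e \<in> T"
      by (auto simp: cball_eq_atLeastAtMost)
    then have "a \<le> ereal (t - e)" "ereal (t + e) \<le> b"
      unfolding a_def b_def by (auto intro: INF_lower SUP_upper)
    moreover have "ereal (t - e) < ereal t" "ereal t < ereal (t + e)"
      using e(1) by auto
    ultimately show ?thesis
      by (meson order.strict_trans1 order.strict_trans2)
  qed
  have "a < b"
  proof -
    obtain t where "t \<in> T" using False by blast
    from ab[OF this] show ?thesis by (meson order.strict_trans)
  qed
  moreover have "isCont f t" if "a < ereal t" "ereal t < b" for t
    using T[OF that] assms(3) by (simp add: continuous_on_eq_continuous_at[OF assms(1)])
  ultimately obtain F where "\<forall>t. a < ereal t \<longrightarrow> ereal t < b \<longrightarrow> (F has_vector_derivative f t) (at t)"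
    using einterval_antiderivative[of a b f] by metis
  with ab show ?thesis by blast
qed simp

section \<open>Parallel frames along the star mean curvature flow\<close>

lemma parallel_matrix_nth [simp]:
  "parallel_matrix \<sigma> k1 k2 $ 1 $ 1 = 0" "parallel_matrix \<sigma> k1 k2 $ 1 $ 2 = - \<sigma>"
  "parallel_matrix \<sigma> k1 k2 $ 1 $ 3 = 0" "parallel_matrix \<sigma> k1 k2 $ 1 $ 4 = 0"
  "parallel_matrix \<sigma> k1 k2 $ 2 $ 1 = 1" "parallel_matrix \<sigma> k1 k2 $ 2 $ 2 = 0"
  "parallel_matrix \<sigma> k1 k2 $ 2 $ 3 = - k1" "parallel_matrix \<sigma> k1 k2 $ 2 $ 4 = - k2"
  "parallel_matrix \<sigma> k1 k2 $ 3 $ 1 = 0" "parallel_matrix \<sigma> k1 k2 $ 3 $ 2 = k1"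
  "parallel_matrix \<sigma> k1 k2 $ 3 $ 3 = 0" "parallel_matrix \<sigma> k1 k2 $ 3 $ 4 = 0"
  "parallel_matrix \<sigma> k1 k2 $ 4 $ 1 = 0" "parallel_matrix \<sigma> k1 k2 $ 4 $ 2 = k2"
  "parallel_matrix \<sigma> k1 k2 $ 4 $ 3 = 0" "parallel_matrix \<sigma> k1 k2 $ 4 $ 4 = 0"
  by (simp_all add: parallel_matrix_def)

lemma smooth_on_Complex:
  assumes "open S" "smooth_on S f" "smooth_on S h"
  shows "smooth_on S (\<lambda>x t. Complex (f x t) (h x t))"
proof -
  have "smooth_on S (\<lambda>x t. complex_of_real (f x t) + \<i> * complex_of_real (h x t))"
    by (intro smooth_on_add smooth_on_linear[of S "\<lambda>r. \<i> * complex_of_real r"]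
        smooth_on_linear[of S complex_of_real] bounded_linear_of_real
        bounded_linear_const_mult assms)
  then show ?thesis by (simp add: Complex_eq)
qed

lemma partials_Complex:
  assumes "(\<lambda>(x, t). f x t) differentiable at (x, t)" "(\<lambda>(x, t). h x t) differentiable at (x, t)"
  shows "dx (\<lambda>x t. Complex (f x t) (h x t)) x t = Complex (dx f x t) (dx h x t)"
    and "dt (\<lambda>x t. Complex (f x t) (h x t)) x t = Complex (dt f x t) (dt h x t)"
  using assms[THEN has_vector_derivative_dx] assms[THEN has_vector_derivative_dt]
  by (auto simp: dx_def[of "\<lambda>x t. Complex (f x t) (h x t)"] dt_def[of "\<lambda>x t. Complex (f x t) (h x t)"]
      has_vector_derivative_complex_iff has_real_derivative_iff_has_vector_derivative
      intro!: vector_derivative_at)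

text \<open>
  The locale is interpreted twice below: for the given frame, and for the frame obtained from it
  by a time-dependent rotation of the normal plane, whose principal curvatures are different.
\<close>

locale framed_star_flow =
  fixes \<sigma> :: real and J T :: "real set"
    and \<gamma> :: "real \<Rightarrow> real \<Rightarrow> real^4" and g :: "real \<Rightarrow> real \<Rightarrow> real^4^4"
    and k1 k2 :: "real \<Rightarrow> real \<Rightarrow> real"
  assumes sigma: "\<sigma> = 1 \<or> \<sigma> = - 1"
    and J: "open J" "is_interval J" and T: "open T" "is_interval T"
    and flow: "star_mcf \<sigma> J T \<gamma>"
    and frame: "parallel_frame \<sigma> J T \<gamma> g k1 k2"
begin

text \<open>
  The flow gives the frame two connection matrices: \<open>temporal\<close> for \<open>\<partial>\<^sub>t\<close> and \<open>spatial\<close> for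
  \<open>\<partial>\<^sub>x\<close>. The latter is the prescribed matrix of a parallel frame, the former is to be determined.
\<close>

definition temporal where "temporal x t = matrix_inv (g x t) ** dt g x t"

abbreviation spatial where "spatial x t \<equiv> parallel_matrix \<sigma> (k1 x t) (k2 x t)"

lemma open_domain: "open (J \<times> T)"
  using J T by (simp add: open_Times)

lemma smooth_g: "smooth_on (J \<times> T) g"
  using frame by (simp add: parallel_frame_def)

lemma frame_at:
  assumes "x \<in> J" "t \<in> T"
  shows "g x t \<in> SO_group \<sigma>" "column 1 (g x t) = \<gamma> x t" "column 2 (g x t) = dx \<gamma> x t"
    "matrix_inv (g x t) ** dx g x t = spatial x t"
    "matrix_inv (g x t) ** g x t = mat 1" "g x t ** matrix_inv (g x t) = mat 1"
proof -
  show g: "g x t \<in> SO_group \<sigma>" "column 1 (g x t) = \<gamma> x t" "column 2 (g x t) = dx \<gamma> x t"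
    "matrix_inv (g x t) ** dx g x t = spatial x t"
    using frame assms by (auto simp: parallel_frame_def)
  show "matrix_inv (g x t) ** g x t = mat 1" "g x t ** matrix_inv (g x t) = mat 1"
    by (rule SO_group_inverse[OF sigma g(1)])+
qed

lemma differentiable_on_domain:
  assumes "smooth_on (J \<times> T) f" "x \<in> J" "t \<in> T"
  shows "(\<lambda>(x, t). f x t) differentiable at (x, t)"
  using smooth_on_differentiable assms by blast

text \<open>
  On the group the inverse is linear in the transpose, so it inherits smoothness without any
  quotient rule.
\<close>

lemma smooth_inv: "smooth_on (J \<times> T) (\<lambda>x t. matrix_inv (g x t))"
proof -
  have "smooth_on (J \<times> T) (\<lambda>x t. gram \<sigma> ** transpose (g x t) ** gram \<sigma>)"
    by (intro smooth_on_bilinear[OF open_domain bounded_bilinear_matrix_mult] smooth_on_const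
        smooth_on_linear[OF open_domain bounded_linear_transpose] smooth_g)
  then show ?thesis
    by (rule smooth_on_cong[OF open_domain, rotated])
      (auto simp: SO_group_inverse(1)[OF sigma frame_at(1)])
qed

lemma smooth_temporal: "smooth_on (J \<times> T) temporal"
  unfolding temporal_def[abs_def]
  by (intro smooth_on_bilinear[OF open_domain bounded_bilinear_matrix_mult]
      smooth_inv smooth_on_dt smooth_g)

lemma smooth_spatial: "smooth_on (J \<times> T) spatial"
  by (rule smooth_on_cong[OF open_domain, of "\<lambda>x t. matrix_inv (g x t) ** dx g x t"])
    (auto simp: frame_at intro!: smooth_inv smooth_on_dx smooth_g
      smooth_on_bilinear[OF open_domain bounded_bilinear_matrix_mult])

lemma smooth_entry:
  fixes M :: "real \<Rightarrow> real \<Rightarrow> real^4^4"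
  assumes "smooth_on (J \<times> T) M"
  shows "smooth_on (J \<times> T) (\<lambda>x t. M x t $ i $ j)"
  by (rule smooth_on_linear[OF open_domain bounded_linear_entry assms])

lemma smooth_k1: "smooth_on (J \<times> T) k1" and smooth_k2: "smooth_on (J \<times> T) k2"
  using smooth_entry[OF smooth_spatial, of 3 2] smooth_entry[OF smooth_spatial, of 4 2] by simp_all

lemma partials_entry:
  fixes M :: "real \<Rightarrow> real \<Rightarrow> real^4^4"
  assumes "smooth_on (J \<times> T) M" "x \<in> J" "t \<in> T"
  shows "dx M x t $ i $ j = dx (\<lambda>x t. M x t $ i $ j) x t"
    "dt M x t $ i $ j = dt (\<lambda>x t. M x t $ i $ j) x t"
  using partials_linear[OF bounded_linear_entry differentiable_on_domain[OF assms]] by simp_all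

lemma frame_equation_x: "x \<in> J \<Longrightarrow> t \<in> T \<Longrightarrow> dx g x t = g x t ** spatial x t"
  and frame_equation_t: "x \<in> J \<Longrightarrow> t \<in> T \<Longrightarrow> dt g x t = g x t ** temporal x t"
  by (simp_all add: frame_at(4)[symmetric] temporal_def matrix_mul_assoc frame_at(6))

text \<open>
  The derivative in \<open>t\<close> of \<open>g\<^sup>T G g = G\<close>: the temporal matrix lies in the Lie algebra of the
  isometry group.
\<close>

lemma temporal_skew:
  assumes "x \<in> J" "t \<in> T"
  shows "transpose (temporal x t) ** gram \<sigma> + gram \<sigma> ** temporal x t = 0"
proof -
  note bb = bounded_bilinear_matrix_mult
  note S = smooth_on_linear[OF open_domain bounded_linear_transpose smooth_g]
  note S' = smooth_on_bilinear[OF open_domain bb S smooth_on_const[of _ "gram \<sigma>"]]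
  note D = differentiable_on_domain[OF _ assms]
  have "dt (\<lambda>x t. transpose (g x t) ** gram \<sigma> ** g x t) x t = dt (\<lambda>x t. gram \<sigma>) x t"
    by (rule dt_cong[OF open_domain]) (use assms frame_at(1) in \<open>auto simp: SO_group_def\<close>)
  moreover have "dt (\<lambda>x t. transpose (g x t) ** gram \<sigma> ** g x t) x t =
      transpose (g x t) ** gram \<sigma> ** dt g x t + transpose (dt g x t) ** gram \<sigma> ** g x t"
    by (simp add: partials_bilinear(2)[OF bb D[OF S'] D[OF smooth_g]] dt_def[of "\<lambda>x t. gram \<sigma>"]
        partials_bilinear(2)[OF bb D[OF S] D[OF smooth_on_const[of _ "gram \<sigma>"]]]
        partials_linear(2)[OF bounded_linear_transpose D[OF smooth_g]])
  moreover have "transpose (g x t) ** gram \<sigma> ** dt g x t =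
      (transpose (g x t) ** gram \<sigma> ** g x t) ** temporal x t"
    by (simp add: frame_equation_t assms matrix_mul_assoc)
  moreover have "transpose (dt g x t) ** gram \<sigma> ** g x t =
      transpose (temporal x t) ** (transpose (g x t) ** gram \<sigma> ** g x t)"
    by (simp add: frame_equation_t assms matrix_mul_assoc matrix_transpose_mul)
  ultimately show ?thesis
    using frame_at(1)[OF assms] by (simp add: SO_group_def dt_def add.commute)
qed

text \<open>
  The second column of \<open>g\<^sub>x = g P\<close>, with \<open>P\<close> the spatial matrix, is the acceleration
  \<open>- \<sigma> e\<^sub>0 + k\<^sub>1 e\<^sub>2 + k\<^sub>2 e\<^sub>3\<close>. Its normal part drops the multiple of the position vector.
\<close>

lemma mean_curvature:
  assumes "x \<in> J" "t \<in> T"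
  shows "mean_curvature_vector \<sigma> (\<lambda>y. \<gamma> y t) x =
    k1 x t *\<^sub>R column 3 (g x t) + k2 x t *\<^sub>R column 4 (g x t)"
proof -
  let ?e = "\<lambda>j. column j (g x t)"
  have "dx (dx \<gamma>) x t = dx (\<lambda>x t. column 2 (g x t)) x t"
    by (rule dx_cong[OF open_domain]) (use assms frame_at in auto)
  also have "\<dots> = g x t *v column 2 (spatial x t)"
    using partials_linear(1)[OF bounded_linear_column differentiable_on_domain[OF smooth_g assms]]
    by (simp add: frame_equation_x assms column_matrix_mult)
  also have "\<dots> = - \<sigma> *\<^sub>R ?e 1 + k1 x t *\<^sub>R ?e 3 + k2 x t *\<^sub>R ?e 4"
    by (subst frame_matrix_columns[of "g x t", symmetric], subst frame_matrix_mult_vec)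
      (simp add: column_def)
  finally have acc: "dx (dx \<gamma>) x t = - \<sigma> *\<^sub>R ?e 1 + k1 x t *\<^sub>R ?e 3 + k2 x t *\<^sub>R ?e 4" .
  have e: "?e j = g x t *v axis j 1" for j
    by (simp add: matrix_vector_mult_basis)
  have orth: "bform \<sigma> (?e i) (?e j) = bform \<sigma> (axis i 1) (axis j 1)" for i j
    unfolding e by (rule bform_SO_group[OF frame_at(1)[OF assms]])
  have lin: "bform \<sigma> (a *\<^sub>R u + b *\<^sub>R v + c *\<^sub>R w) z =
      a * bform \<sigma> u z + b * bform \<sigma> v z + c * bform \<sigma> w z" for a b c u v w z
    by (simp add: bform_def algebra_simps)
  have "mean_curvature_vector \<sigma> (\<lambda>y. \<gamma> y t) x =
      normal_part \<sigma> (?e 1) (?e 2) (dx (dx \<gamma>) x t) /\<^sub>R bform \<sigma> (?e 2) (?e 2)"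
    by (simp add: mean_curvature_vector_def dx_def[abs_def] frame_at[OF assms] Let_def)
  also have "\<dots> = k1 x t *\<^sub>R ?e 3 + k2 x t *\<^sub>R ?e 4"
    using sigma unfolding normal_part_def acc lin orth
    by (auto simp: bform_def axis_def)
  finally show ?thesis .
qed

text \<open>
  This is the flow equation \<open>\<gamma>\<^sub>t = k\<^sub>1 e\<^sub>3 - k\<^sub>2 e\<^sub>2\<close>, read in the coordinates of the frame.
\<close>

lemma temporal_first_column:
  assumes "x \<in> J" "t \<in> T"
  shows "column 1 (temporal x t) = vector [0, 0, - k2 x t, k1 x t]"
proof -
  let ?e = "\<lambda>j. column j (g x t)"
  have "frame_matrix (\<gamma> x t) (dx \<gamma> x t) (?e 3) (?e 4) \<in> SO_group \<sigma>"
    using frame_matrix_columns[of "g x t"] frame_at[OF assms] by simp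
  then have "dt \<gamma> x t = k1 x t *\<^sub>R ?e 4 - k2 x t *\<^sub>R ?e 3"
    using flow assms by (simp add: star_mcf_def mean_curvature hodge_star_eq[OF sigma])
  also have "\<dots> = g x t *v vector [0, 0, - k2 x t, k1 x t]"
    by (subst (3) frame_matrix_columns[of "g x t", symmetric], subst frame_matrix_mult_vec) simp
  finally have "dt \<gamma> x t = g x t *v vector [0, 0, - k2 x t, k1 x t]" .
  moreover have "dt \<gamma> x t = dt (\<lambda>x t. column 1 (g x t)) x t"
    by (rule dt_cong[OF open_domain]) (use assms frame_at in auto)
  moreover have "\<dots> = g x t *v column 1 (temporal x t)"
    using partials_linear(2)[OF bounded_linear_column differentiable_on_domain[OF smooth_g assms]]
    by (simp add: frame_equation_t assms column_matrix_mult)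
  ultimately have "(matrix_inv (g x t) ** g x t) *v column 1 (temporal x t) =
      (matrix_inv (g x t) ** g x t) *v vector [0, 0, - k2 x t, k1 x t]"
    by (simp add: matrix_vector_mul_assoc[symmetric])
  then show ?thesis by (simp add: frame_at(5)[OF assms])
qed

text \<open>
  The compatibility condition of \<open>g\<^sub>x = g P\<close> and \<open>g\<^sub>t = g Q\<close>, with \<open>P\<close> the spatial and \<open>Q\<close>
  the temporal matrix: equality of the mixed partials of \<open>g\<close>, multiplied by the inverse of \<open>g\<close> from the left.
\<close>

lemma zero_curvature:
  assumes "x \<in> J" "t \<in> T"
  shows "dt spatial x t + temporal x t ** spatial x t = dx temporal x t + spatial x t ** temporal x t"
proof -
  note bb = bounded_bilinear_matrix_mult
  note D = differentiable_on_domain[OF _ assms]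
  have "dt (dx g) x t = dt (\<lambda>x t. g x t ** spatial x t) x t"
    by (rule dt_cong[OF open_domain]) (use assms frame_equation_x in auto)
  also have "\<dots> = g x t ** (dt spatial x t + temporal x t ** spatial x t)"
    by (simp add: partials_bilinear(2)[OF bb D[OF smooth_g] D[OF smooth_spatial]] frame_equation_t assms
        matrix_add_ldistrib matrix_mul_assoc)
  finally have 1: "dt (dx g) x t = g x t ** (dt spatial x t + temporal x t ** spatial x t)" .
  have "dx (dt g) x t = dx (\<lambda>x t. g x t ** temporal x t) x t"
    by (rule dx_cong[OF open_domain]) (use assms frame_equation_t in auto)
  also have "\<dots> = g x t ** (dx temporal x t + spatial x t ** temporal x t)"
    by (simp add: partials_bilinear(1)[OF bb D[OF smooth_g] D[OF smooth_temporal]] frame_equation_x assms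
        matrix_add_ldistrib matrix_mul_assoc)
  finally have "g x t ** (dt spatial x t + temporal x t ** spatial x t) =
      g x t ** (dx temporal x t + spatial x t ** temporal x t)"
    using 1 mixed_partials_commute[OF J T smooth_g assms] by simp
  then have "(matrix_inv (g x t) ** g x t) ** (dt spatial x t + temporal x t ** spatial x t) =
      (matrix_inv (g x t) ** g x t) ** (dx temporal x t + spatial x t ** temporal x t)"
    by (simp add: matrix_mul_assoc[symmetric])
  then show ?thesis by (simp add: frame_at(5)[OF assms])
qed

text \<open>
  The first column is known from the flow, and skewness transports it to the first row and leaves
  only the three entries (3,2), (4,2) and (4,3) undetermined.
\<close>

lemma temporal_entries:
  assumes "x \<in> J" "t \<in> T"
  shows "temporal x t $ 1 $ 1 = 0" "temporal x t $ 2 $ 1 = 0"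
    "temporal x t $ 3 $ 1 = - k2 x t" "temporal x t $ 4 $ 1 = k1 x t"
    "temporal x t $ 1 $ 2 = 0" "temporal x t $ 2 $ 2 = 0"
    "temporal x t $ 3 $ 3 = 0" "temporal x t $ 4 $ 4 = 0"
    "temporal x t $ 2 $ 3 = - temporal x t $ 3 $ 2" "temporal x t $ 2 $ 4 = - temporal x t $ 4 $ 2"
    "temporal x t $ 3 $ 4 = - temporal x t $ 4 $ 3"
proof -
  show col: "temporal x t $ 1 $ 1 = 0" "temporal x t $ 2 $ 1 = 0"
    "temporal x t $ 3 $ 1 = - k2 x t" "temporal x t $ 4 $ 1 = k1 x t"
    using temporal_first_column[OF assms] by (auto simp: vec_eq_iff forall_4 column_def)
  show "temporal x t $ 1 $ 2 = 0" "temporal x t $ 2 $ 2 = 0"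
    "temporal x t $ 3 $ 3 = 0" "temporal x t $ 4 $ 4 = 0"
    "temporal x t $ 2 $ 3 = - temporal x t $ 3 $ 2" "temporal x t $ 2 $ 4 = - temporal x t $ 4 $ 2"
    "temporal x t $ 3 $ 4 = - temporal x t $ 4 $ 3"
    using temporal_skew[OF assms] sigma col
    by (auto simp: matrix_eq_4 matrix_mult_4 transpose_nth gram_def)
qed

text \<open>
  Since the first column of the spatial matrix is the second unit vector, the first column of the
  zero curvature equation expresses the second column of the temporal matrix through its first one.
\<close>

lemma temporal_second_column:
  assumes "x \<in> J" "t \<in> T"
  shows "temporal x t $ 3 $ 2 = - dx k2 x t" "temporal x t $ 4 $ 2 = dx k1 x t"
proof -
  have "dx temporal x t $ 3 $ 1 = - dx k2 x t"
    unfolding partials_entry(1)[OF smooth_temporal assms]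
    using dx_cong[OF open_domain, of x t "\<lambda>x t. temporal x t $ 3 $ 1" "\<lambda>x t. - k2 x t"]
      assms temporal_entries partials_linear(1)[OF bounded_linear_minus[OF bounded_linear_ident]
        differentiable_on_domain[OF smooth_k2 assms]] by simp
  moreover have "dx temporal x t $ 4 $ 1 = dx k1 x t"
    unfolding partials_entry(1)[OF smooth_temporal assms]
    using dx_cong[OF open_domain, of x t "\<lambda>x t. temporal x t $ 4 $ 1" k1]
      assms temporal_entries by simp
  \<comment> \<open>the first column of the spatial matrix is constant\<close>
  moreover have "dt spatial x t $ 3 $ 1 = 0" "dt spatial x t $ 4 $ 1 = 0"
    unfolding partials_entry(2)[OF smooth_spatial assms] by (simp_all add: dt_def)
  ultimately show "temporal x t $ 3 $ 2 = - dx k2 x t" "temporal x t $ 4 $ 2 = dx k1 x t"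
    using zero_curvature[OF assms] temporal_entries[OF assms]
    by (simp_all add: matrix_eq_4 matrix_mult_4)
qed

text \<open>
  The entries (3,2), (4,2) and (4,3) of the zero curvature equation, after the entries found above
  have been inserted. Only the speed \<open>temporal x t $ 4 $ 3\<close> of the normal frame remains free.
\<close>

lemma curvature_evolution:
  assumes "x \<in> J" "t \<in> T"
  shows "dt k1 x t = - dx (dx k2) x t - \<sigma> * k2 x t + temporal x t $ 4 $ 3 * k2 x t"
    and "dt k2 x t = dx (dx k1) x t + \<sigma> * k1 x t - temporal x t $ 4 $ 3 * k1 x t"
    and "dx (\<lambda>x t. temporal x t $ 4 $ 3) x t = - (k1 x t * dx k1 x t + k2 x t * dx k2 x t)"
proof -
  have "dx temporal x t $ 3 $ 2 = - dx (dx k2) x t"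
    unfolding partials_entry(1)[OF smooth_temporal assms]
    using dx_cong[OF open_domain, of x t "\<lambda>x t. temporal x t $ 3 $ 2" "\<lambda>x t. - dx k2 x t"]
      assms temporal_second_column partials_linear(1)[OF bounded_linear_minus[OF bounded_linear_ident]
        differentiable_on_domain[OF smooth_on_dx[OF smooth_k2] assms]] by simp
  moreover have "dx temporal x t $ 4 $ 2 = dx (dx k1) x t"
    unfolding partials_entry(1)[OF smooth_temporal assms]
    using dx_cong[OF open_domain, of x t "\<lambda>x t. temporal x t $ 4 $ 2" "dx k1"]
      assms temporal_second_column by simp
  moreover have "dx temporal x t $ 4 $ 3 = dx (\<lambda>x t. temporal x t $ 4 $ 3) x t"
    by (rule partials_entry(1)[OF smooth_temporal assms])
  moreover have "dt spatial x t $ 3 $ 2 = dt k1 x t" "dt spatial x t $ 4 $ 2 = dt k2 x t"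
    "dt spatial x t $ 4 $ 3 = 0"
    unfolding partials_entry(2)[OF smooth_spatial assms] by (simp_all add: dt_def)
  ultimately show "dt k1 x t = - dx (dx k2) x t - \<sigma> * k2 x t + temporal x t $ 4 $ 3 * k2 x t"
    "dt k2 x t = dx (dx k1) x t + \<sigma> * k1 x t - temporal x t $ 4 $ 3 * k1 x t"
    "dx (\<lambda>x t. temporal x t $ 4 $ 3) x t = - (k1 x t * dx k1 x t + k2 x t * dx k2 x t)"
    using zero_curvature[OF assms] temporal_entries[OF assms] temporal_second_column[OF assms]
    by (simp_all add: matrix_eq_4 matrix_mult_4 algebra_simps)
qed

section \<open>The nonlinear Schroedinger equation\<close>

text \<open>
  The normalization replaces the remaining free entry by \<open>- |k|\<^sup>2 / 2\<close>, which turns the linear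
  terms \<open>temporal x t $ 4 $ 3 * k2\<close> and \<open>- temporal x t $ 4 $ 3 * k1\<close> into the cubic nonlinearity.
\<close>

lemma time_normalized_imp_NLS:
  assumes "time_normalized J T g k1 k2"
  shows "solves_NLS \<sigma> J T (\<lambda>x t. Complex (k1 x t) (k2 x t))"
  unfolding solves_NLS_def
proof (intro conjI ballI)
  let ?k = "\<lambda>x t. Complex (k1 x t) (k2 x t)"
  show "smooth_on (J \<times> T) ?k"
    by (rule smooth_on_Complex[OF open_domain smooth_k1 smooth_k2])
  fix x t assume xt: "x \<in> J" "t \<in> T"
  note D = differentiable_on_domain[OF _ xt]
  have "dx (dx ?k) x t = dx (\<lambda>x t. Complex (dx k1 x t) (dx k2 x t)) x t"
    using xt by (intro dx_cong[OF open_domain])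
      (auto intro: partials_Complex differentiable_on_domain smooth_k1 smooth_k2)
  also have "\<dots> = Complex (dx (dx k1) x t) (dx (dx k2) x t)"
    by (rule partials_Complex[OF D[OF smooth_on_dx[OF smooth_k1]] D[OF smooth_on_dx[OF smooth_k2]]])
  finally have xx: "dx (dx ?k) x t = Complex (dx (dx k1) x t) (dx (dx k2) x t)" .
  have b: "temporal x t $ 4 $ 3 = - ((k1 x t)\<^sup>2 + (k2 x t)\<^sup>2) / 2"
    using assms xt by (simp add: time_normalized_def temporal_def)
  show "dt ?k x t = \<i> * (dx (dx ?k) x t + of_real \<sigma> * ?k x t
      + 1/2 * of_real ((cmod (?k x t))\<^sup>2) * ?k x t)"
    unfolding xx partials_Complex(2)[OF D[OF smooth_k1] D[OF smooth_k2]]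
      curvature_evolution(1,2)[OF xt] b
    by (simp add: complex_eq_iff cmod_power2 field_simps)
qed

text \<open>
  The amount by which the frame fails to be time normalized.
\<close>

definition defect where
  "defect x t = temporal x t $ 4 $ 3 + ((k1 x t)\<^sup>2 + (k2 x t)\<^sup>2) / 2"

lemma smooth_defect: "smooth_on (J \<times> T) defect"
proof -
  note m = smooth_on_bilinear[OF open_domain bounded_bilinear_mult]
  have "smooth_on (J \<times> T) (\<lambda>x t. temporal x t $ 4 $ 3 + (1/2) * (k1 x t * k1 x t + k2 x t * k2 x t))"
    by (intro smooth_on_add[OF open_domain] m smooth_entry smooth_on_const
        smooth_temporal smooth_k1 smooth_k2)
  moreover have "(\<lambda>x t. temporal x t $ 4 $ 3 + (1/2) * (k1 x t * k1 x t + k2 x t * k2 x t)) = defect"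
    by (simp add: fun_eq_iff defect_def power2_eq_square)
  ultimately show ?thesis by simp
qed

text \<open>
  The third equation of \<open>curvature_evolution\<close> says that the \<open>x\<close>-derivative of the entry (4,3) is
  \<open>- (|k|\<^sup>2 / 2)\<^sub>x\<close>. Hence a rotation that depends on \<open>t\<close> alone can compensate for the defect.
\<close>

lemma defect_independent_of_x:
  assumes "x \<in> J" "y \<in> J" "t \<in> T"
  shows "defect x t = defect y t"
proof -
  have "((\<lambda>x. defect x t) has_vector_derivative 0) (at x within J)" if x: "x \<in> J" for x
  proof -
    have h: "((\<lambda>y. f y t) has_real_derivative dx f x t) (at x)" if "smooth_on (J \<times> T) f" for f
      using has_vector_derivative_dx[OF differentiable_on_domain[OF that x assms(3)]]
      by (simp add: has_real_derivative_iff_has_vector_derivative)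
    have "((\<lambda>x. defect x t) has_real_derivative
        dx (\<lambda>x t. temporal x t $ 4 $ 3) x t + (k1 x t * dx k1 x t + k2 x t * dx k2 x t)) (at x)"
      unfolding defect_def
      by (auto intro!: derivative_eq_intros h[OF smooth_k1] h[OF smooth_k2]
          h[OF smooth_entry[OF smooth_temporal]])
    then show ?thesis
      by (simp add: curvature_evolution(3)[OF x assms(3)] has_vector_derivative_at_within
          has_real_derivative_iff_has_vector_derivative)
  qed
  then obtain c where "\<And>x. x \<in> J \<Longrightarrow> defect x t = c"
    using has_vector_derivative_zero_constant[of J "\<lambda>x. defect x t"] J(2) is_interval_convex
    by blast
  then show ?thesis using assms by simp
qed

text \<open>
  Multiplication by a rotation \<open>R\<close> depending on \<open>t\<close> conjugates both connection matrices by \<open>R\<close>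
  and adds \<open>R\<^sup>T R\<^sub>t\<close>, which is \<open>\<theta>' *\<^sub>R rotation_generator\<close>, to the temporal one. Conjugation keeps the
  parallel shape and multiplies \<open>k\<close> by \<open>exp (- \<i> \<theta>)\<close>; it also keeps the entry (4,3) of the skew
  temporal matrix. The speed \<open>\<theta>'\<close> is chosen to cancel the defect, and \<open>|k|\<close> is unchanged.
\<close>

lemma rotated_frame_normalized:
  assumes \<theta>: "\<And>x t. x \<in> J \<Longrightarrow> t \<in> T \<Longrightarrow> (\<theta> has_vector_derivative - defect x t) (at t)"
  defines "h \<equiv> \<lambda>x t. g x t ** normal_rotation (\<theta> t)"
    and "l1 \<equiv> \<lambda>x t. cos (\<theta> t) * k1 x t + sin (\<theta> t) * k2 x t"
    and "l2 \<equiv> \<lambda>x t. cos (\<theta> t) * k2 x t - sin (\<theta> t) * k1 x t"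
  shows "parallel_frame \<sigma> J T \<gamma> h l1 l2" and "time_normalized J T h l1 l2"
proof -
  let ?R = "\<lambda>t. normal_rotation (\<theta> t)"
  note bb = bounded_bilinear_matrix_mult
  have sR: "smooth_on (J \<times> T) (\<lambda>x t. ?R t)"
    using smooth_on_linear[OF open_domain bounded_linear_minus[OF bounded_linear_ident] smooth_defect]
    by (rule smooth_on_normal_rotation[OF open_domain]) (use \<theta> in auto)
  have sh: "smooth_on (J \<times> T) h"
    unfolding h_def by (intro smooth_on_bilinear[OF open_domain bb] smooth_g sR)
  have inv: "matrix_inv (h x t) = transpose (?R t) ** matrix_inv (g x t)"
    if "x \<in> J" "t \<in> T" for x t
  proof (rule matrix_inv_unique)
    have "h x t ** (transpose (?R t) ** matrix_inv (g x t)) =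
        g x t ** (?R t ** transpose (?R t)) ** matrix_inv (g x t)"
      by (simp add: h_def matrix_mul_assoc)
    then show "h x t ** (transpose (?R t) ** matrix_inv (g x t)) = mat 1"
      by (simp add: normal_rotation_mult_inverse frame_at that)
    have "transpose (?R t) ** matrix_inv (g x t) ** h x t =
        transpose (?R t) ** (matrix_inv (g x t) ** g x t) ** ?R t"
      by (simp add: h_def matrix_mul_assoc)
    then show "transpose (?R t) ** matrix_inv (g x t) ** h x t = mat 1"
      by (simp add: normal_rotation_mult_inverse frame_at that)
  qed
  have xh: "matrix_inv (h x t) ** dx h x t = parallel_matrix \<sigma> (l1 x t) (l2 x t)"
    if xt: "x \<in> J" "t \<in> T" for x t
  proof -
    have "dx h x t = g x t ** spatial x t ** ?R t"
      unfolding h_def partials_bilinear(1)[OF bb differentiable_on_domain[OF smooth_g xt]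
          differentiable_on_domain[OF sR xt]]
      by (simp add: dx_normal_rotation frame_equation_x xt)
    then have "matrix_inv (h x t) ** dx h x t =
        transpose (?R t) ** (matrix_inv (g x t) ** g x t) ** spatial x t ** ?R t"
      by (simp add: inv xt matrix_mul_assoc)
    then show ?thesis
      by (simp add: frame_at(5)[OF xt] matrix_eq_4 matrix_mult_4 transpose_nth normal_rotation_def
          l1_def l2_def algebra_simps)
  qed
  have col: "column 1 (h x t) = column 1 (g x t)" "column 2 (h x t) = column 2 (g x t)" for x t
    by (simp_all add: h_def vec_eq_iff column_def matrix_mult_4 normal_rotation_def)
  show "parallel_frame \<sigma> J T \<gamma> h l1 l2"
    using sh xh col frame_at SO_group_normal_rotation[OF frame_at(1)]
    by (auto simp: parallel_frame_def h_def)
  show "time_normalized J T h l1 l2"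
    unfolding time_normalized_def
  proof (intro ballI)
    fix x t assume xt: "x \<in> J" "t \<in> T"
    let ?K = "- defect x t *\<^sub>R rotation_generator"
    have "dt h x t = g x t ** (?R t ** ?K) + g x t ** temporal x t ** ?R t"
      unfolding h_def partials_bilinear(2)[OF bb differentiable_on_domain[OF smooth_g xt]
          differentiable_on_domain[OF sR xt]]
      by (simp only: dt_normal_rotation[OF \<theta>[OF xt]] frame_equation_t xt)
    then have "matrix_inv (h x t) ** dt h x t =
        transpose (?R t) ** (matrix_inv (g x t) ** g x t) ** ?R t ** ?K
        + transpose (?R t) ** (matrix_inv (g x t) ** g x t) ** temporal x t ** ?R t"
      by (simp only: inv[OF xt] matrix_mul_assoc matrix_add_ldistrib)
    then have "matrix_inv (h x t) ** dt h x t = ?K + transpose (?R t) ** temporal x t ** ?R t"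
      by (simp only: frame_at(5)[OF xt] matrix_mul_rid normal_rotation_mult_inverse matrix_mul_lid)
    then have "(matrix_inv (h x t) ** dt h x t) $ 4 $ 3 =
        (?K + transpose (?R t) ** temporal x t ** ?R t) $ 4 $ 3"
      by (simp only:)
    also have "\<dots> = - defect x t + cos (\<theta> t) * (cos (\<theta> t) * temporal x t $ 4 $ 3)
        + sin (\<theta> t) * (sin (\<theta> t) * temporal x t $ 4 $ 3)"
      by (simp add: matrix_mult_4 transpose_nth normal_rotation_def rotation_generator_def
          temporal_entries[OF xt] algebra_simps)
    also have "\<dots> = - defect x t + temporal x t $ 4 $ 3"
      by (simp add: mult.assoc[symmetric] distrib_right[symmetric] add.assoc)
    also have "\<dots> = - ((k1 x t)\<^sup>2 + (k2 x t)\<^sup>2) / 2"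
      by (simp add: defect_def field_simps)
    also have "(k1 x t)\<^sup>2 + (k2 x t)\<^sup>2 =
        ((cos (\<theta> t))\<^sup>2 + (sin (\<theta> t))\<^sup>2) * ((k1 x t)\<^sup>2 + (k2 x t)\<^sup>2)"
      by simp
    also have "\<dots> = (l1 x t)\<^sup>2 + (l2 x t)\<^sup>2"
      unfolding l1_def l2_def by algebra
    finally show "(matrix_inv (h x t) ** dt h x t) $ 4 $ 3 = - ((l1 x t)\<^sup>2 + (l2 x t)\<^sup>2) / 2" .
  qed
qed

text \<open>
  The defect does not depend on \<open>x\<close>, so it is integrated in \<open>t\<close> at an arbitrary point of \<open>J\<close>.
\<close>

lemma normalizing_angle_exists:
  "\<exists>\<theta>. \<forall>x\<in>J. \<forall>t\<in>T. (\<theta> has_vector_derivative - defect x t) (at t)"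
proof (cases "J = {}")
  case False
  then obtain a where a: "a \<in> J" by blast
  have "continuous_on T (Pair a)"
    by (rule continuous_on_Pair[OF continuous_on_const continuous_on_id])
  from continuous_on_compose2[OF smooth_on_continuous[OF smooth_defect] this]
  have "continuous_on T (\<lambda>t. - defect a t)"
    using a by (auto intro: continuous_on_minus)
  then obtain \<theta> where "\<forall>t\<in>T. (\<theta> has_vector_derivative - defect a t) (at t)"
    using antiderivative_on_open_interval[OF T] by blast
  then show ?thesis
    using defect_independent_of_x[OF a] by (intro exI[of _ \<theta>]) metis
qed simp

end

theorem theorem3p4:
  fixes \<sigma> :: real and J T :: "real set"
    and \<gamma> :: "real \<Rightarrow> real \<Rightarrow> real^4" and g :: "real \<Rightarrow> real \<Rightarrow> real^4^4"
    and k1 k2 :: "real \<Rightarrow> real \<Rightarrow> real"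
  assumes "\<sigma> = 1 \<or> \<sigma> = - 1"
    and "open J" "is_interval J" "open T" "is_interval T"
    and "star_mcf \<sigma> J T \<gamma>"
    and "parallel_frame \<sigma> J T \<gamma> g k1 k2"
  shows "(time_normalized J T g k1 k2 \<longrightarrow>
            solves_NLS \<sigma> J T (\<lambda>x t. Complex (k1 x t) (k2 x t)))
       \<and> (\<exists>\<theta> l1 l2.
            parallel_frame \<sigma> J T \<gamma> (\<lambda>x t. g x t ** normal_rotation (\<theta> t)) l1 l2 \<and>
            time_normalized J T (\<lambda>x t. g x t ** normal_rotation (\<theta> t)) l1 l2 \<and>
            solves_NLS \<sigma> J T (\<lambda>x t. Complex (l1 x t) (l2 x t)))"
proof -
  interpret framed_star_flow \<sigma> J T \<gamma> g k1 k2
    using assms by unfold_locales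
  obtain \<theta> where "\<And>x t. x \<in> J \<Longrightarrow> t \<in> T \<Longrightarrow> (\<theta> has_vector_derivative - defect x t) (at t)"
    using normalizing_angle_exists by blast
  from rotated_frame_normalized[OF this] obtain l1 l2 where
    l: "parallel_frame \<sigma> J T \<gamma> (\<lambda>x t. g x t ** normal_rotation (\<theta> t)) l1 l2"
      "time_normalized J T (\<lambda>x t. g x t ** normal_rotation (\<theta> t)) l1 l2"
    by blast
  then interpret rot: framed_star_flow \<sigma> J T \<gamma> "\<lambda>x t. g x t ** normal_rotation (\<theta> t)" l1 l2
    using assms by unfold_locales
  show ?thesis
    using time_normalized_imp_NLS rot.time_normalized_imp_NLS[OF l(2)] l by blast
qed

end
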